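(* Let $K\subset\mathbb{R}^3$ be a $3$-dimensional unbounded convex polyhedron that does not disconnect $\mathbb{R}^3$. Then $\mathbb{R}^3\setminus K$ and $\mathbb{R}^3\setminus\operatorname{Int}K$ are polynomial images of $\mathbb{R}^3$; that is, there exist polynomial maps $f,g:\mathbb{R}^3\to\mathbb{R}^3$ such that $f(\mathbb{R}^3)=\mathbb{R}^3\setminus K$ and $g(\mathbb{R}^3)=\mathbb{R}^3\setminus\operatorname{Int}K$.
   Context: A convex polyhedron in $\mathbb{R}^n$ is a finite intersection of closed affine half-spaces (the family of half-spaces is allowed to be empty, which describes $\mathbb{R}^n$ itself as a convex polyhedron). Its dimension is its dimension as a topological manifold with boundary, and $\operatorname{Int}K$ denotes the interior of $K$ as a topological manifold with boundary. A convex polyhedron $K\subset\mathbb{R}^n$ disconnects $\mathbb{R}^n$ if $\mathbb{R}^n\setminus K$ is not connected; this happens if and only if $K$ is a layer, that is, $K$ is affinely equivalent to $[-a,a]\times\mathbb{R}^{n-1}$ for some real $a$ (a hyperplane if $a=0$). A map $f=(f_1,\dots,f_m):\mathbb{R}^n\to\mathbb{R}^m$ is polynomial if each component $f_k$ belongs to $\mathbb{R}[x_1,\dots,x_n]$.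
   Formalization: The polyhedron K is additionally assumed to be different from the whole space R^3, since for K = R^3 the complement is empty and cannot be a polynomial image of R^3. *)

theory Defs
  imports "HOL-Analysis.Analysis"
begin

(* In dimension 0 the half-space condition 0 <= x 0 is vacuous, since points of Euclidean_space n
   are sequences vanishing from index n on. *)
definition Euclidean_half_space :: "nat \<Rightarrow> (nat \<Rightarrow> real) topology" where
  "Euclidean_half_space n = subtopology (Euclidean_space n) {x. 0 \<le> x 0}"

definition manifold_with_boundary :: "nat \<Rightarrow> 'a topology \<Rightarrow> bool" where
  "manifold_with_boundary n X \<longleftrightarrow>
     Hausdorff_space X \<and> second_countable X \<and>
     (\<forall>x\<in>topspace X. \<exists>U V. openin X U \<and> x \<in> U \<and> openin (Euclidean_half_space n) V \<and>
        subtopology X U homeomorphic_space subtopology (Euclidean_half_space n) V)"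

definition manifold_interior :: "nat \<Rightarrow> 'a topology \<Rightarrow> 'a set" where
  "manifold_interior n X =
     {x \<in> topspace X. \<exists>U V. openin X U \<and> x \<in> U \<and> openin (Euclidean_space n) V \<and>
        subtopology X U homeomorphic_space subtopology (Euclidean_space n) V}"

(* The library predicate connected holds of the empty set, so UNIV does not disconnect the space. *)
definition disconnects :: "(real ^ 'n) set \<Rightarrow> bool" where
  "disconnects K \<longleftrightarrow> \<not> connected (UNIV - K)"

(* real_polynomial_function on real ^ 'n is the algebra generated by the constants and the linear
   forms, i.e. the functions given by polynomials in the coordinates. *)
definition polynomial_map :: "(real ^ 'n \<Rightarrow> real ^ 'm) \<Rightarrow> bool" where
  "polynomial_map f \<longleftrightarrow> (\<forall>k. real_polynomial_function (\<lambda>x. f x $ k))"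

end

theory Submission
  imports Defs "HOL-Homology.Invariance_of_Domain"
begin

text \<open>Unless \<open>K\<close> is a half-space, two of its half-spaces have non-parallel normals. Then there is a
  direction \<open>e\<close> parallel to no bounding plane and pointing out of one of these two half-spaces and
  into the other; a positive combination of the two normals is orthogonal to \<open>e\<close> and bounded
  above on \<open>K\<close>. In suitable affine coordinates \<open>(u, t, y)\<close>, with \<open>u\<close> along \<open>e\<close>, the
  polyhedron is therefore given by upper and lower bounds \<open>c h\<close> for \<open>u\<close> that are affine in
  \<open>(y, t)\<close>, and it lies in the half-space \<open>t \<ge> 1\<close>.

  The map sends \<open>(a, b, y)\<close> to the point with coordinates \<open>t = a * b\<^sup>2\<close>, \<open>y\<close> and \<open>u = height c b a\<close>.
  The height is a polynomial in \<open>b\<close> that takes the value \<open>c h\<close> at a node \<open>\<nu> h\<close>, positive for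
  upper and negative for lower bounds, plus a barrier term that has the sign of \<open>b\<close>, vanishes exactly
  at the nodes, and tends to infinity as \<open>b \<rightarrow> 0\<close> along \<open>a * b\<^sup>2 = t \<noteq> 0\<close>. On such a curve the branch
  \<open>b > 0\<close> covers everything above the least upper bound and, if \<open>t \<ge> 1\<close>, nothing below it; the
  branch \<open>b < 0\<close> does the same for the lower bounds. The lines with \<open>t < 1\<close> miss \<open>K\<close>, so that
  there only surjectivity matters.\<close>

section \<open>Polynomials with prescribed one-sided ranges\<close>

lemmas real_polynomial_function_intros =
  real_polynomial_function.intros(2-4) real_polynomial_function_diff real_polynomial_function_divide
  real_polynomial_function_power real_polynomial_function_sum real_polynomial_function_prod

text \<open>The gaps ensure that at most one node is closer than 1/2 to a given \<open>b\<close>,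
  and that such a node has the sign of \<open>b\<close>.\<close>

locale separated_nodes =
  fixes F :: "'i set" and \<nu> :: "'i \<Rightarrow> real"
  assumes finite_F: "finite F"
    and separated: "\<lbrakk>h \<in> F; k \<in> F; h \<noteq> k\<rbrakk> \<Longrightarrow> 1 \<le> \<bar>\<nu> h - \<nu> k\<bar>"
    and away: "h \<in> F \<Longrightarrow> 1 \<le> \<bar>\<nu> h\<bar>"
begin

definition nodal :: "real \<Rightarrow> real" where
  "nodal b = (\<Prod>h\<in>F. (b - \<nu> h)\<^sup>2)"

text \<open>The square of a Lagrange basis polynomial; squaring makes it nonnegative and gives it
  double zeros at the other nodes.\<close>

definition bump :: "'i \<Rightarrow> real \<Rightarrow> real" where
  "bump h b = (\<Prod>k\<in>F - {h}. ((b - \<nu> k) / (\<nu> h - \<nu> k))\<^sup>2)"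

definition total :: "real \<Rightarrow> real" where
  "total b = (\<Sum>h\<in>F. bump h b)"

definition weight :: "'i \<Rightarrow> real \<Rightarrow> real" where
  "weight h b = bump h b * (3 - total b)\<^sup>2 / 4"

text \<open>The first summand pays for the failure of the weights to sum to 1, the second for the
  weights of remote nodes; the third is a surplus that is positive off the nodes.\<close>

definition barrier :: "real \<Rightarrow> real" where
  "barrier b = (total b - 1)\<^sup>2 * (total b + 4)
     + 4 * real (card F) * nodal b * (3 - total b)\<^sup>2 + nodal b"

text \<open>Bounds the absolute values of \<open>c\<close> by a polynomial in them. As
  \<open>c\<close> will vary with the coordinates, a maximum would not give a polynomial
  map.\<close>

definition size_bound :: "('i \<Rightarrow> real) \<Rightarrow> real" where
  "size_bound c = 1 + (\<Sum>h\<in>F. (c h)\<^sup>2)"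

text \<open>On the curve \<open>a * b\<^sup>2 = t\<close> with \<open>b \<noteq> 0\<close> the
  factor \<open>b * (1 + a\<^sup>2)\<close> equals \<open>b + t\<^sup>2 / b ^ 3\<close>: it has the
  sign of \<open>b\<close> and, if \<open>t \<noteq> 0\<close>, blows up at
  \<open>b = 0\<close>.\<close>

definition height :: "('i \<Rightarrow> real) \<Rightarrow> real \<Rightarrow> real \<Rightarrow> real" where
  "height c b a = (\<Sum>h\<in>F. c h * weight h b) + size_bound c * (b * (1 + a\<^sup>2)) * barrier b"

section \<open>Interpolation at the nodes and its error\<close>

lemma nodal_nonneg: "0 \<le> nodal b"
  by (simp add: nodal_def prod_nonneg)

lemma nodal_eq_0_iff: "nodal b = 0 \<longleftrightarrow> b \<in> \<nu> ` F"
  using finite_F by (auto simp: nodal_def)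

lemma bump_nonneg: "0 \<le> bump h b"
  by (simp add: bump_def prod_nonneg)

lemma bump_node:
  assumes "h \<in> F" "m \<in> F"
  shows "bump h (\<nu> m) = (if h = m then 1 else 0)"
proof (cases "h = m")
  case True
  have "((\<nu> m - \<nu> k) / (\<nu> m - \<nu> k))\<^sup>2 = 1" if "k \<in> F - {m}" for k
    using that separated[of m k] assms by auto
  then show ?thesis
    using True by (simp add: bump_def)
next
  case False
  then show ?thesis
    using finite_F assms by (auto simp: bump_def)
qed

text \<open>The denominators in \<open>bump\<close> are at least 1, and its numerator lacks only the
  factor \<open>(b - \<nu> h)\<^sup>2\<close> of \<open>nodal\<close>, which is at least 1/4
  here.\<close>

lemma bump_le_nodal:
  assumes h: "h \<in> F" and far: "1/2 \<le> \<bar>b - \<nu> h\<bar>"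
  shows "bump h b \<le> 4 * nodal b"
proof -
  let ?R = "\<Prod>k\<in>F - {h}. (b - \<nu> k)\<^sup>2"
  have "bump h b \<le> ?R"
    unfolding bump_def
  proof (intro prod_mono conjI)
    fix k assume k: "k \<in> F - {h}"
    then have "1 \<le> (\<nu> h - \<nu> k)\<^sup>2"
      using separated[of h k] h by (metis DiffE abs_le_square_iff abs_one insert_iff one_power2)
    then have "(b - \<nu> k)\<^sup>2 * 1 \<le> (b - \<nu> k)\<^sup>2 * (\<nu> h - \<nu> k)\<^sup>2"
      by (intro mult_left_mono) auto
    then show "((b - \<nu> k) / (\<nu> h - \<nu> k))\<^sup>2 \<le> (b - \<nu> k)\<^sup>2"
      using \<open>1 \<le> (\<nu> h - \<nu> k)\<^sup>2\<close> by (simp add: power_divide divide_le_eq)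
  qed auto
  moreover have "nodal b = (b - \<nu> h)\<^sup>2 * ?R"
    unfolding nodal_def using finite_F h by (simp add: prod.remove)
  moreover have "1/4 \<le> (b - \<nu> h)\<^sup>2"
    using far power_mono[of "1/2" "\<bar>b - \<nu> h\<bar>" 2] by (simp add: power2_eq_square)
  moreover have "0 \<le> ?R"
    by (simp add: prod_nonneg)
  ultimately show ?thesis
    using mult_right_mono[of "1/4" "(b - \<nu> h)\<^sup>2" ?R] by linarith
qed

lemma total_nonneg: "0 \<le> total b"
  by (simp add: total_def sum_nonneg bump_nonneg)

lemma weight_nonneg: "0 \<le> weight h b"
  by (simp add: weight_def bump_nonneg)

lemma total_node: "m \<in> F \<Longrightarrow> total (\<nu> m) = 1"
  using finite_F by (simp add: total_def bump_node)

lemma weight_node: "\<lbrakk>h \<in> F; m \<in> F\<rbrakk> \<Longrightarrow> weight h (\<nu> m) = (if h = m then 1 else 0)"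
  by (simp add: weight_def bump_node total_node)

lemma nodal_le_barrier: "nodal b \<le> barrier b"
  by (simp add: barrier_def nodal_nonneg total_nonneg)

lemma barrier_node: "m \<in> F \<Longrightarrow> barrier (\<nu> m) = 0"
  using nodal_eq_0_iff[of "\<nu> m"] by (simp add: barrier_def total_node)

lemma size_bound_ge_1: "1 \<le> size_bound c"
  by (simp add: size_bound_def sum_nonneg)

lemma abs_le_size_bound:
  assumes "h \<in> F"
  shows "\<bar>c h\<bar> \<le> size_bound c"
proof -
  have "(c h)\<^sup>2 \<le> (\<Sum>h\<in>F. (c h)\<^sup>2)"
    using assms finite_F by (intro member_le_sum) auto
  moreover have "\<bar>c h\<bar> \<le> 1 + (c h)\<^sup>2"
    using zero_le_power2[of "\<bar>c h\<bar> - 1"] by (simp add: power2_diff)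
  ultimately show ?thesis
    by (simp add: size_bound_def)
qed

lemma height_node: "m \<in> F \<Longrightarrow> height c (\<nu> m) a = c m"
  using finite_F by (simp add: height_def barrier_node weight_node if_distrib cong: if_cong)

text \<open>The cubic \<open>U (3 - U)\<^sup>2 / 4\<close> takes the value 1 with derivative 0 at \<open>U = 1\<close>; this makes the
  interpolation error quadratic at the nodes, so that the barrier can absorb it.\<close>

lemma interpolation_error:
  assumes m: "m \<in> F" and far: "\<And>h. h \<in> F - {m} \<Longrightarrow> 1/2 \<le> \<bar>b - \<nu> h\<bar>"
  shows "\<bar>(\<Sum>h\<in>F. c h * weight h b) - c m\<bar> \<le> size_bound c / 2 * (barrier b - nodal b)"
proof -
  define M where "M = size_bound c"
  define W where "W = (\<Sum>h\<in>F. weight h b)"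
  let ?U = "total b"
  have M: "1 \<le> M" "\<And>h. h \<in> F \<Longrightarrow> \<bar>c h\<bar> \<le> M"
    using size_bound_ge_1 abs_le_size_bound by (auto simp: M_def)
  have "W = ?U * (3 - ?U)\<^sup>2 / 4"
    by (simp add: W_def weight_def total_def sum_distrib_right sum_divide_distrib)
  then have W1: "W - 1 = (?U - 1)\<^sup>2 * (?U - 4) / 4"
    by (simp add: power2_eq_square field_simps)
  have "\<bar>W - 1\<bar> = (?U - 1)\<^sup>2 * \<bar>?U - 4\<bar> / 4"
    unfolding W1 by (simp add: abs_mult)
  \<comment> \<open>Since \<open>total\<close> is nonnegative, changing \<open>- 4\<close> into
    \<open>+ 4\<close> bounds the absolute value by a polynomial, the first summand of
    \<open>barrier\<close>.\<close>
  also have "\<dots> \<le> (?U - 1)\<^sup>2 * (?U + 4) / 4"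
    using total_nonneg[of b] by (intro divide_right_mono mult_left_mono) auto
  finally have W: "\<bar>W - 1\<bar> \<le> (?U - 1)\<^sup>2 * (?U + 4) / 4" .
  have rest: "(\<Sum>h\<in>F - {m}. weight h b) \<le> real (card F) * (nodal b * (3 - ?U)\<^sup>2)"
  proof -
    have "weight h b \<le> nodal b * (3 - ?U)\<^sup>2" if h: "h \<in> F - {m}" for h
      using mult_right_mono[OF bump_le_nodal, of h b "(3 - ?U)\<^sup>2 / 4"] far[OF h] h
      by (simp add: weight_def)
    then have "(\<Sum>h\<in>F - {m}. weight h b) \<le> real (card (F - {m})) * (nodal b * (3 - ?U)\<^sup>2)"
      by (rule sum_bounded_above)
    also have "\<dots> \<le> real (card F) * (nodal b * (3 - ?U)\<^sup>2)"
      using finite_F by (intro mult_right_mono) (auto simp: nodal_nonneg card_mono)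
    finally show ?thesis .
  qed
  \<comment> \<open>The error splits into one part from the weights not summing to 1 and one from
    the values at the other nodes.\<close>
  have "(\<Sum>h\<in>F. c h * weight h b) - c m = c m * (W - 1) + (\<Sum>h\<in>F. (c h - c m) * weight h b)"
    by (simp add: W_def algebra_simps sum_subtractf sum_distrib_left)
  also have "(\<Sum>h\<in>F. (c h - c m) * weight h b) = (\<Sum>h\<in>F - {m}. (c h - c m) * weight h b)"
    using finite_F m by (simp add: sum.remove)
  finally have "\<bar>(\<Sum>h\<in>F. c h * weight h b) - c m\<bar>
      \<le> \<bar>c m * (W - 1)\<bar> + \<bar>\<Sum>h\<in>F - {m}. (c h - c m) * weight h b\<bar>"
    by (metis abs_triangle_ineq)
  also have "\<bar>c m * (W - 1)\<bar> \<le> M * ((?U - 1)\<^sup>2 * (?U + 4) / 4)"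
    unfolding abs_mult using W M m by (intro mult_mono) auto
  also have "\<bar>\<Sum>h\<in>F - {m}. (c h - c m) * weight h b\<bar> \<le> (\<Sum>h\<in>F - {m}. 2 * M * weight h b)"
  proof (intro order_trans[OF sum_abs] sum_mono)
    fix h assume "h \<in> F - {m}"
    then have "\<bar>c h - c m\<bar> \<le> 2 * M"
      using M(2)[of h] M(2)[OF m] by auto
    then show "\<bar>(c h - c m) * weight h b\<bar> \<le> 2 * M * weight h b"
      by (simp add: abs_mult weight_nonneg mult_right_mono)
  qed
  also have "\<dots> \<le> 2 * M * (real (card F) * (nodal b * (3 - ?U)\<^sup>2))"
    unfolding sum_distrib_left[symmetric] using rest M by (intro mult_left_mono) auto
  finally have "\<bar>(\<Sum>h\<in>F. c h * weight h b) - c m\<bar>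
      \<le> M * ((?U - 1)\<^sup>2 * (?U + 4) / 4) + 2 * M * (real (card F) * (nodal b * (3 - ?U)\<^sup>2))"
    by simp
  also have "\<dots> \<le> M / 2 * (barrier b - nodal b)"
    using mult_nonneg_nonneg[of M "(?U - 1)\<^sup>2 * (?U + 4)"] M total_nonneg[of b]
    by (simp add: barrier_def algebra_simps)
  finally show ?thesis
    by (simp add: M_def)
qed

text \<open>Half of \<open>size_bound c * barrier b\<close> absorbs the interpolation error. Because
  \<open>barrier\<close> dominates \<open>nodal\<close>, what remains is still at least
  \<open>nodal b\<close> times the factor \<open>b * (1 + a\<^sup>2)\<close>.\<close>

lemma height_lower:
  assumes "m \<in> F" "\<And>h. h \<in> F - {m} \<Longrightarrow> 1/2 \<le> \<bar>b - \<nu> h\<bar>" and q: "1/2 \<le> b * (1 + a\<^sup>2)"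
  shows "c m + nodal b * (b * (1 + a\<^sup>2)) \<le> height c b a"
proof -
  let ?M = "size_bound c" and ?q = "b * (1 + a\<^sup>2)"
  have M: "1 \<le> ?M"
    by (rule size_bound_ge_1)
  have "nodal b * ?q \<le> ?M * (nodal b * ?q)"
    using M q nodal_nonneg[of b] mult_right_mono[of 1 ?M "nodal b * ?q"] by simp
  also have "\<dots> = ?M * nodal b / 2 + ?M * ((?q - 1/2) * nodal b)"
    by (simp add: algebra_simps)
  also have "\<dots> \<le> ?M * nodal b / 2 + ?M * ((?q - 1/2) * barrier b)"
    using M q nodal_le_barrier[of b] by (intro add_left_mono mult_left_mono) auto
  also have "\<dots> = ?M * ?q * barrier b - ?M / 2 * (barrier b - nodal b)"
    by (simp add: algebra_simps)
  finally show ?thesis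
    using abs_le_D2[OF interpolation_error[OF assms(1,2), of c]] by (simp add: height_def)
qed

text \<open>A node closer than 1/2 to \<open>b\<close> is positive as \<open>b\<close> is; if there
  is none, any positive node will do.\<close>

lemma nearest_positive_node:
  assumes "0 < b" "j \<in> F" "0 < \<nu> j"
  obtains m where "m \<in> F" "0 < \<nu> m" "\<And>h. h \<in> F - {m} \<Longrightarrow> 1/2 \<le> \<bar>b - \<nu> h\<bar>"
proof (cases "\<exists>m\<in>F. \<bar>b - \<nu> m\<bar> < 1/2")
  case True
  then obtain m where m: "m \<in> F" "\<bar>b - \<nu> m\<bar> < 1/2"
    by blast
  have "0 < \<nu> m"
    using m away[of m] \<open>0 < b\<close> by linarith
  moreover have "1/2 \<le> \<bar>b - \<nu> h\<bar>" if "h \<in> F - {m}" for h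
  proof -
    have "1 \<le> \<bar>\<nu> h - \<nu> m\<bar>"
      using separated m that by auto
    then show ?thesis
      using m by linarith
  qed
  ultimately show ?thesis
    using that m by blast
next
  case False
  then show ?thesis
    using that[of j] assms by fastforce
qed

text \<open>This is where \<open>t \<ge> 1\<close> enters: for \<open>b < 1/2\<close> it forces
  \<open>a * b \<ge> 1\<close> and \<open>a \<ge> 1\<close>, so \<open>b * a\<^sup>2\<close> is
  already at least 1.\<close>

lemma half_le_barrier_factor:
  fixes a b :: real
  assumes "0 < b" "1 \<le> a * b\<^sup>2"
  shows "1/2 \<le> b * (1 + a\<^sup>2)"
proof (cases "1/2 \<le> b")
  case True
  moreover have "b * 1 \<le> b * (1 + a\<^sup>2)"
    using assms by (intro mult_left_mono) auto
  ultimately show ?thesis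
    by linarith
next
  case False
  have a: "0 < a"
    using assms by (metis less_le_trans zero_less_mult_pos2 zero_less_one zero_less_power)
  have "a * b\<^sup>2 \<le> a * b * 1"
    using a assms False by (simp add: power2_eq_square)
  then have "1 \<le> a * b"
    using assms by simp
  moreover have "a * b \<le> a * 1"
    using a False by (intro mult_left_mono) auto
  ultimately have "1 * 1 \<le> a * (a * b)"
    by (intro mult_mono) auto
  then show ?thesis
    using assms by (simp add: algebra_simps power2_eq_square)
qed

lemma height_above_positive_node:
  assumes "0 < b" "1 \<le> a * b\<^sup>2" "j \<in> F" "0 < \<nu> j"
  obtains m where "m \<in> F" "0 < \<nu> m" "c m \<le> height c b a"
    "nodal b \<noteq> 0 \<Longrightarrow> c m < height c b a"
proof -
  obtain m where m: "m \<in> F" "0 < \<nu> m" "\<And>h. h \<in> F - {m} \<Longrightarrow> 1/2 \<le> \<bar>b - \<nu> h\<bar>"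
    using nearest_positive_node assms by metis
  have q: "1/2 \<le> b * (1 + a\<^sup>2)"
    using half_le_barrier_factor assms by blast
  have "nodal b * (1/2) \<le> nodal b * (b * (1 + a\<^sup>2))"
    using q by (intro mult_left_mono nodal_nonneg)
  then have "c m + nodal b / 2 \<le> height c b a"
    using height_lower[of m b a c] m q by simp
  then show thesis
    using that[of m] m nodal_nonneg[of b] by simp
qed

section \<open>Values attained by the height along a curve\<close>

lemma continuous_on_height:
  assumes "continuous_on S f" "continuous_on S g"
  shows "continuous_on S (\<lambda>x. height c (f x) (g x))"
  unfolding height_def weight_def barrier_def total_def bump_def nodal_def
    divide_inverse power_mult_distrib
  using assms by (intro continuous_intros) auto

lemma height_large_near_0:
  assumes t: "t \<noteq> 0" and j: "j \<in> F" "0 < \<nu> j"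
  obtains b where "0 < b" "b \<le> 1/2" "x \<le> height c b (t / b\<^sup>2)"
proof -
  \<comment> \<open>\<open>p\<close> bounds \<open>nodal\<close> from below on the interval from 0
    to 1/2, and \<open>D\<close> is the size of the barrier factor that lifts the height from
    \<open>c j\<close> to \<open>x\<close>. As \<open>b \<le> 1\<close>, the choice
    \<open>b \<le> t\<^sup>2 / D\<close> gives \<open>t\<^sup>2 / b ^ 3 \<ge> D\<close>.\<close>
  define p where "p = (1/4 :: real) ^ card F"
  define D where "D = 1 + \<bar>x - c j\<bar> / p"
  define b where "b = min (1/2) (t\<^sup>2 / D)"
  have p: "0 < p"
    by (simp add: p_def)
  have D: "0 < D"
    using p by (simp add: D_def add_pos_nonneg)
  have "0 < t\<^sup>2 / D"
    using t D by (intro divide_pos_pos) auto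
  then have b: "0 < b" "b \<le> 1/2" "b \<le> t\<^sup>2 / D"
    unfolding b_def by (auto intro: min.cobounded1 min.cobounded2 simp only: min_less_iff_conj)
  have far: "1/2 \<le> \<bar>b - \<nu> h\<bar>" if "h \<in> F" for h
    using away[OF that] b by linarith
  have "(\<Prod>h\<in>F. 1/4) \<le> nodal b"
    unfolding nodal_def
  proof (intro prod_mono conjI)
    fix h assume "h \<in> F"
    then show "1/4 \<le> (b - \<nu> h)\<^sup>2"
      using power_mono[OF far, of h 2] by (simp add: power2_eq_square)
  qed auto
  then have P: "p \<le> nodal b"
    by (simp add: p_def)
  have "D * b \<le> t\<^sup>2"
    using b D by (simp add: field_simps)
  also have "t\<^sup>2 \<le> t\<^sup>2 * (b * (1 / b\<^sup>2)) * (b * 1)"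
    using b by (simp add: power2_eq_square)
  also have "\<dots> \<le> t\<^sup>2 * (b * (1 / b\<^sup>2)) * (b * (1 / b\<^sup>2))"
  proof -
    have "b\<^sup>2 \<le> 1"
      using b by (simp add: power_le_one)
    then have "1 \<le> 1 / b\<^sup>2"
      using b by simp
    then show ?thesis
      using b by (intro mult_left_mono) auto
  qed
  also have "\<dots> = b * (b * (t / b\<^sup>2)\<^sup>2)"
    by (simp add: power2_eq_square)
  finally have "D \<le> b * (t / b\<^sup>2)\<^sup>2"
    using b by simp
  then have q: "D \<le> b * (1 + (t / b\<^sup>2)\<^sup>2)"
    using b by (simp add: distrib_left)
  have D1: "1 \<le> D"
    using p by (simp add: D_def)
  have "\<bar>x - c j\<bar> \<le> p * D"
    using p by (simp add: D_def field_simps)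
  also have "\<dots> \<le> nodal b * (b * (1 + (t / b\<^sup>2)\<^sup>2))"
    using P q p D by (intro mult_mono) auto
  also have "\<dots> \<le> height c b (t / b\<^sup>2) - c j"
    using height_lower[of j b "t / b\<^sup>2" c] j far q D1 by auto
  finally show thesis
    using that[of b] b by auto
qed

text \<open>A crossing of the level \<open>x\<close> may happen at a node, but the last one before a node with a value
  below \<open>x\<close> does not, because every positive node is a local minimum of the height.\<close>

lemma height_attains_above:
  assumes t: "t \<noteq> 0" and j: "j \<in> F" "0 < \<nu> j" and x: "c j < x"
  obtains b where "0 < b" "nodal b \<noteq> 0" "height c b (t / b\<^sup>2) = x"
proof -
  let ?f = "\<lambda>b. height c b (t / b\<^sup>2)"
  obtain b0 where b0: "0 < b0" "b0 \<le> 1/2" "x \<le> ?f b0"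
    using height_large_near_0 t j by metis
  have \<nu>j: "1 \<le> \<nu> j"
    using away[of j] j by simp
  have cont: "continuous_on {b0..\<nu> j} ?f"
    using b0 by (intro continuous_on_height continuous_intros) auto
  \<comment> \<open>The largest element of this compact set is the last crossing of the level
    \<open>x\<close> before \<open>\<nu> j\<close>.\<close>
  define A where "A = {b \<in> {b0..\<nu> j}. x \<le> ?f b}"
  have "closed A"
    unfolding A_def
    by (rule continuous_on_closed_Collect_le[OF continuous_on_const cont closed_atLeastAtMost])
  moreover have "bounded A"
    by (rule bounded_subset[of "{b0..\<nu> j}"]) (auto simp: A_def)
  ultimately have "compact A"
    by (simp add: compact_eq_bounded_closed)
  moreover have "b0 \<in> A"
    using b0 \<nu>j by (simp add: A_def)
  ultimately obtain s where s: "s \<in> A" "\<And>b. b \<in> A \<Longrightarrow> b \<le> s"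
    using compact_attains_sup[of A] by blast
  have s': "b0 \<le> s" "s \<le> \<nu> j" "x \<le> ?f s"
    using s by (auto simp: A_def)
  have fj: "?f (\<nu> j) < x"
    using x j by (simp add: height_node)
  then have s_less: "s < \<nu> j"
    using s' by (metis leD order_le_less)
  have fs: "?f s = x"
  proof -
    have "\<exists>b\<ge>s. b \<le> \<nu> j \<and> ?f b = x"
      using IVT2'[of ?f "\<nu> j" x s] s' fj continuous_on_subset[OF cont, of "{s..\<nu> j}"] by auto
    then obtain b where "s \<le> b" "b \<le> \<nu> j" "?f b = x"
      by blast
    moreover from this have "b \<in> A"
      using s' by (simp add: A_def)
    ultimately show ?thesis
      using s(2)[of b] by auto
  qed
  have "nodal s \<noteq> 0"
  proof
    assume "nodal s = 0"
    then obtain k where k: "k \<in> F" "s = \<nu> k"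
      by (auto simp: nodal_eq_0_iff)
    \<comment> \<open>A point to the right of \<open>s\<close> but within 1/2 of it: all nodes other
      than \<open>k\<close> stay at distance at least 1/2, so the height there is at least
      \<open>c k = x\<close>, against the maximality of \<open>s\<close>.\<close>
    define b where "b = min (\<nu> j) (s + 1/2)"
    have b: "s < b" "b \<le> \<nu> j" "b \<le> s + 1/2"
      using s_less by (auto simp: b_def)
    have \<nu>k: "1 \<le> \<nu> k"
      using away[OF k(1)] k(2) s' b0 by linarith
    have "1/2 \<le> b * (1 + (t / b\<^sup>2)\<^sup>2)"
      using mult_mono[of "1/2" b 1 "1 + (t / b\<^sup>2)\<^sup>2"] b \<nu>k k by auto
    moreover from this have "0 \<le> nodal b * (b * (1 + (t / b\<^sup>2)\<^sup>2))"
      using b b0 s' by (intro mult_nonneg_nonneg nodal_nonneg) auto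
    moreover have "1/2 \<le> \<bar>b - \<nu> h\<bar>" if "h \<in> F - {k}" for h
    proof -
      have "1 \<le> \<bar>\<nu> h - \<nu> k\<bar>"
        using separated k that by auto
      then show ?thesis
        using k b by linarith
    qed
    ultimately have "c k \<le> ?f b"
      using height_lower[of k b "t / b\<^sup>2" c] k by auto
    moreover have "c k = x"
      using fs k by (simp add: height_node)
    ultimately have "b \<in> A"
      using b s' by (simp add: A_def)
    then show False
      using s(2)[of b] b by simp
  qed
  then show thesis
    using that[of s] s' b0 fs by auto
qed

lemma height_unbounded_above:
  assumes "j \<in> F"
  obtains b where "1 \<le> b" "x \<le> height c b 0"
proof -
  \<comment> \<open>To the right of every node by at least 1, so that \<open>nodal b \<ge> 1\<close>
    and the barrier term contributes at least \<open>b\<close>.\<close>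
  define b where "b = 1 + (\<Sum>h\<in>F. \<bar>\<nu> h\<bar>) + \<bar>x - c j\<bar>"
  have far: "1 \<le> b - \<nu> h" if "h \<in> F" for h
    using member_le_sum[of h F "\<lambda>h. \<bar>\<nu> h\<bar>"] finite_F that by (auto simp: b_def)
  have b: "1 \<le> b" "\<bar>x - c j\<bar> \<le> b"
    by (auto simp: b_def sum_nonneg)
  have P: "1 \<le> nodal b"
    unfolding nodal_def using far by (intro prod_ge_1) (auto simp: one_le_power)
  have far': "1/2 \<le> \<bar>b - \<nu> h\<bar>" if "h \<in> F - {j}" for h
    using far[of h] that by auto
  have "1 * b \<le> nodal b * b"
    using b P by (intro mult_right_mono) auto
  moreover have "c j + nodal b * b \<le> height c b 0"
    using height_lower[OF assms far', of 0 c] b by simp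
  ultimately have "c j + b \<le> height c b 0"
    by linarith
  then show thesis
    using that[of b] b by auto
qed

section \<open>Reflection, exchanging upper and lower bounds\<close>

lemma separated_nodes_uminus: "separated_nodes F (\<lambda>h. - \<nu> h)"
proof
  show "1 \<le> \<bar>- \<nu> h - - \<nu> k\<bar>" if "h \<in> F" "k \<in> F" "h \<noteq> k" for h k
    using separated[OF that] by simp
qed (auto simp: finite_F away)

lemma nodal_uminus: "separated_nodes.nodal F (\<lambda>h. - \<nu> h) (- b) = nodal b"
proof -
  have "(- b - - \<nu> h)\<^sup>2 = (b - \<nu> h)\<^sup>2" for h
    by (simp add: power2_eq_square algebra_simps)
  then show ?thesis
    by (simp add: nodal_def separated_nodes.nodal_def[OF separated_nodes_uminus])
qed

text \<open>Negating \<open>b\<close>, the nodes and the values preserves all the squared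
  ingredients and reverses only the values and the factor \<open>b\<close>. Facts about positive
  nodes thus transfer to negative ones.\<close>

lemma height_uminus:
  "separated_nodes.height F (\<lambda>h. - \<nu> h) (\<lambda>h. - c h) (- b) a = - height c b a"
proof -
  interpret R: separated_nodes F "\<lambda>h. - \<nu> h"
    by (rule separated_nodes_uminus)
  have "(- b - - \<nu> k) / (- \<nu> h - - \<nu> k) = (b - \<nu> k) / (\<nu> h - \<nu> k)" for h k
    using minus_divide_divide[of "b - \<nu> k" "\<nu> h - \<nu> k"] by simp
  then have bump: "R.bump h (- b) = bump h b" for h
    by (simp add: R.bump_def bump_def)
  then have total: "R.total (- b) = total b"
    by (simp add: R.total_def total_def)
  with bump have "R.weight h (- b) = weight h b" for h
    by (simp add: R.weight_def weight_def)
  moreover have "R.barrier (- b) = barrier b"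
    by (simp add: R.barrier_def barrier_def total nodal_uminus)
  moreover have "R.size_bound (\<lambda>h. - c h) = size_bound c"
    by (simp add: R.size_bound_def size_bound_def)
  ultimately show ?thesis
    by (simp add: R.height_def height_def sum_negf)
qed

lemma height_below_negative_node:
  assumes "b < 0" "1 \<le> a * b\<^sup>2" "j \<in> F" "\<nu> j < 0"
  obtains m where "m \<in> F" "\<nu> m < 0" "height c b a \<le> c m"
    "nodal b \<noteq> 0 \<Longrightarrow> height c b a < c m"
proof -
  interpret R: separated_nodes F "\<lambda>h. - \<nu> h"
    by (rule separated_nodes_uminus)
  from R.height_above_positive_node[of "- b" a j "\<lambda>h. - c h"] assms that show thesis
    by (auto simp: height_uminus nodal_uminus)
qed

lemma height_attains_below:
  assumes "t \<noteq> 0" "j \<in> F" "\<nu> j < 0" "x < c j"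
  obtains b where "b < 0" "nodal b \<noteq> 0" "height c b (t / b\<^sup>2) = x"
proof -
  interpret R: separated_nodes F "\<lambda>h. - \<nu> h"
    by (rule separated_nodes_uminus)
  obtain b where b: "0 < b" "R.nodal b \<noteq> 0" "R.height (\<lambda>h. - c h) b (t / b\<^sup>2) = - x"
    using R.height_attains_above[of t j "\<lambda>h. - c h" "- x"] assms by auto
  then show thesis
    using that[of "- b"] height_uminus[of c "- b"] nodal_uminus[of "- b"] by auto
qed

text \<open>Treats \<open>t = 0\<close>, where the curve \<open>a * b\<^sup>2 = 0\<close> contains
  the whole line \<open>a = 0\<close> and no blow-up is available; the intermediate value theorem
  suffices there.\<close>

lemma height_surj:
  assumes "j \<in> F"
  obtains b where "height c b 0 = x"
proof -
  interpret R: separated_nodes F "\<lambda>h. - \<nu> h"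
    by (rule separated_nodes_uminus)
  obtain b1 where b1: "1 \<le> b1" "x \<le> height c b1 0"
    using height_unbounded_above assms by metis
  obtain b2 where b2: "1 \<le> b2" "- x \<le> R.height (\<lambda>h. - c h) b2 0"
    using R.height_unbounded_above assms by metis
  have "height c (- b2) 0 \<le> x"
    using b2 height_uminus[of c "- b2" 0] by simp
  then have "\<exists>b\<ge>- b2. b \<le> b1 \<and> height c b 0 = x"
    using b1 b2 by (intro IVT' continuous_on_height continuous_intros) auto
  then show thesis
    using that by blast
qed

text \<open>For \<open>t < 1\<close> the hypothesis \<open>empty\<close> makes the right-hand side
  true for this \<open>x\<close>, so the one-sided estimates are needed only for
  \<open>t \<ge> 1\<close>. Equality \<open>x = c h\<close> is attained at the node itself.\<close>

lemma closed_fibre: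
  assumes pos: "j \<in> F" "0 < \<nu> j" and neg: "k \<in> F" "\<nu> k < 0"
    and empty: "t < 1 \<Longrightarrow> \<exists>h\<in>F. 0 < \<nu> h \<and> c h < x \<or> \<nu> h < 0 \<and> x < c h"
  shows "(\<exists>a b. a * b\<^sup>2 = t \<and> height c b a = x) \<longleftrightarrow>
    (\<exists>h\<in>F. 0 < \<nu> h \<and> c h \<le> x \<or> \<nu> h < 0 \<and> x \<le> c h)" (is "?L \<longleftrightarrow> ?R")
proof
  assume ?L
  then obtain a b where ab: "a * b\<^sup>2 = t" "height c b a = x"
    by blast
  consider "t < 1" | "1 \<le> t" "0 < b" | "1 \<le> t" "b < 0"
    using ab by fastforce
  then show ?R
  proof cases
    case 1
    then show ?thesis
      using empty by force
  next
    case 2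
    then show ?thesis
      using height_above_positive_node[of b a j c] ab pos by metis
  next
    case 3
    then show ?thesis
      using height_below_negative_node[of b a k c] ab neg by metis
  qed
next
  assume R: ?R
  show ?L
  proof (cases "t = 0")
    case True
    then show ?thesis
      using height_surj[OF pos(1), of c x] by (metis mult_zero_left)
  next
    case False
    have *: ?thesis if "b \<noteq> 0" "height c b (t / b\<^sup>2) = x" for b
      using that by (intro exI[of _ "t / b\<^sup>2"] exI[of _ b]) simp
    from R obtain h where h: "h \<in> F" "0 < \<nu> h \<and> c h \<le> x \<or> \<nu> h < 0 \<and> x \<le> c h"
      by blast
    then consider "x = c h" | "0 < \<nu> h" "c h < x" | "\<nu> h < 0" "x < c h"
      by fastforce
    then show ?thesis
    proof cases
      case 1
      then show ?thesis
        using *[of "\<nu> h"] height_node[OF h(1)] away[OF h(1)] by fastforce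
    next
      case 2
      then show ?thesis
        using height_attains_above[OF False h(1), of c x] * by (metis less_irrefl)
    next
      case 3
      then show ?thesis
        using height_attains_below[OF False h(1), of x c] * by (metis less_irrefl)
    qed
  qed
qed

text \<open>The substitution of \<open>a * nodal b\<close> for \<open>a\<close> removes the nodes from the curve \<open>a * b\<^sup>2 = t\<close> when
  \<open>t \<noteq> 0\<close>, which turns the weak inequalities into strict ones.\<close>

lemma open_fibre:
  assumes pos: "j \<in> F" "0 < \<nu> j" and neg: "k \<in> F" "\<nu> k < 0"
    and empty: "t < 1 \<Longrightarrow> \<exists>h\<in>F. 0 < \<nu> h \<and> c h < x \<or> \<nu> h < 0 \<and> x < c h"
  shows "(\<exists>a b. (a * nodal b) * b\<^sup>2 = t \<and> height c b (a * nodal b) = x) \<longleftrightarrow>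
    (\<exists>h\<in>F. 0 < \<nu> h \<and> c h < x \<or> \<nu> h < 0 \<and> x < c h)" (is "?L \<longleftrightarrow> ?R")
proof
  assume ?L
  then obtain a b where ab: "(a * nodal b) * b\<^sup>2 = t" "height c b (a * nodal b) = x"
    by blast
  consider "t < 1" | "1 \<le> t" "0 < b" "nodal b \<noteq> 0" | "1 \<le> t" "b < 0" "nodal b \<noteq> 0"
    using ab by fastforce
  then show ?R
  proof cases
    case 1
    then show ?thesis
      using empty by force
  next
    case 2
    then show ?thesis
      using height_above_positive_node[of b "a * nodal b" j c] ab pos by metis
  next
    case 3
    then show ?thesis
      using height_below_negative_node[of b "a * nodal b" k c] ab neg by metis
  qed
next
  assume R: ?R
  show ?L
  proof (cases "t = 0")
    case True
    then show ?thesis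
      using height_surj[OF pos(1), of c x] by (metis mult_zero_left)
  next
    case False
    have *: ?thesis if "b \<noteq> 0" "nodal b \<noteq> 0" "height c b (t / b\<^sup>2) = x" for b
      using that by (intro exI[of _ "t / b\<^sup>2 / nodal b"] exI[of _ b]) simp
    from R obtain h where h: "h \<in> F" "0 < \<nu> h \<and> c h < x \<or> \<nu> h < 0 \<and> x < c h"
      by blast
    then show ?thesis
      using height_attains_above[OF False h(1), of c x]
        height_attains_below[OF False h(1), of x c] * by (metis less_irrefl)
  qed
qed

section \<open>Polynomial dependence on all coordinates\<close>

lemma real_polynomial_function_nodal:
  assumes "real_polynomial_function b"
  shows "real_polynomial_function (\<lambda>v. nodal (b v))"
  unfolding nodal_def by (intro real_polynomial_function_intros assms finite_F)

lemma real_polynomial_function_height: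
  assumes c: "\<And>h. h \<in> F \<Longrightarrow> real_polynomial_function (\<lambda>v. c v h)"
    and b: "real_polynomial_function b" and a: "real_polynomial_function a"
  shows "real_polynomial_function (\<lambda>v. height (c v) (b v) (a v))"
proof -
  have bump: "real_polynomial_function (\<lambda>v. bump h (b v))" for h
    unfolding bump_def by (intro real_polynomial_function_intros b finite_Diff finite_F)
  have total: "real_polynomial_function (\<lambda>v. total (b v))"
    unfolding total_def by (intro real_polynomial_function_intros bump finite_F)
  have weight: "real_polynomial_function (\<lambda>v. weight h (b v))" for h
    unfolding weight_def by (intro real_polynomial_function_intros bump total)
  have barrier: "real_polynomial_function (\<lambda>v. barrier (b v))"
    unfolding barrier_def
    by (intro real_polynomial_function_intros total real_polynomial_function_nodal b)
  have size: "real_polynomial_function (\<lambda>v. size_bound (c v))"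
    unfolding size_bound_def by (intro real_polynomial_function_intros c finite_F)
  show ?thesis
    unfolding height_def
    by (intro real_polynomial_function_intros a b c weight barrier size finite_F)
qed

end

section \<open>Coordinates adapted to a polyhedron\<close>

text \<open>By invariance of domain, a subset of the space homeomorphic to an open set of the same
  dimension is open, hence inside the interior. Conversely the interior serves as a chart around
  each of its points.\<close>

lemma manifold_interior_eq_interior:
  fixes K :: "'a::euclidean_space set"
  shows "manifold_interior DIM('a) (top_of_set K) = interior K"
proof -
  obtain f g where "homeomorphic_maps (Euclidean_space DIM('a)) (euclidean :: 'a topology) f g"
    by (rule homeomorphic_maps_Euclidean_space_euclidean)
  then have f: "homeomorphic_map (Euclidean_space DIM('a)) (euclidean :: 'a topology) f"
    and g: "homeomorphic_map (euclidean :: 'a topology) (Euclidean_space DIM('a)) g"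
    using homeomorphic_map_maps homeomorphic_maps_sym by blast+
  have "x \<in> interior K"
    if U: "openin (top_of_set K) U" "x \<in> U" and V: "openin (Euclidean_space DIM('a)) V"
      and UV: "subtopology (top_of_set K) U homeomorphic_space
        subtopology (Euclidean_space DIM('a)) V" for x U V
  proof -
    have "U \<subseteq> K"
      using U openin_imp_subset by blast
    then have "subtopology (top_of_set K) U = top_of_set U"
      by (simp add: subtopology_subtopology inf.absorb2)
    moreover have "V \<subseteq> topspace (Euclidean_space DIM('a))"
      using V by (rule openin_subset)
    then have "homeomorphic_map (subtopology (Euclidean_space DIM('a)) V) (top_of_set (f ` V)) f"
      by (intro homeomorphic_map_subtopologies[OF f]) (simp add: inf.absorb2)
    ultimately have "top_of_set (f ` V) homeomorphic_space top_of_set U"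
      using UV homeomorphic_map_imp_homeomorphic_space homeomorphic_space_sym
        homeomorphic_space_trans by metis
    then obtain p q where "homeomorphic_maps (top_of_set (f ` V)) (top_of_set U) p q"
      unfolding homeomorphic_space_def by blast
    then have pq: "continuous_on (f ` V) p" "p ` f ` V = U" "inj_on p (f ` V)"
      unfolding homeomorphic_maps_iff_homeomorphism homeomorphism_def
      by (auto intro: inj_on_inverseI)
    have "open (f ` V)"
      using homeomorphic_map_openness_eq[OF f, of V] V by simp
    then have "open U"
      using invariance_of_domain pq by metis
    then show ?thesis
      using \<open>U \<subseteq> K\<close> U by (meson interior_maximal subsetD)
  qed
  moreover have "\<exists>U V. openin (top_of_set K) U \<and> x \<in> U \<and> openin (Euclidean_space DIM('a)) V \<and>
      subtopology (top_of_set K) U homeomorphic_space subtopology (Euclidean_space DIM('a)) V"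
    if "x \<in> interior K" for x
  proof (intro exI conjI)
    show "openin (top_of_set K) (interior K)"
      by (simp add: interior_subset open_subset)
    show V: "openin (Euclidean_space DIM('a)) (g ` interior K)"
      using homeomorphic_map_openness_eq[OF g, of "interior K"] by simp
    have "subtopology (top_of_set K) (interior K) = top_of_set (interior K)"
      by (simp add: subtopology_subtopology inf.absorb2 interior_subset)
    moreover have "homeomorphic_map (top_of_set (interior K))
        (subtopology (Euclidean_space DIM('a)) (g ` interior K)) g"
      using openin_subset[OF V]
      by (intro homeomorphic_map_subtopologies[OF g]) (simp add: inf.absorb2)
    ultimately show "subtopology (top_of_set K) (interior K) homeomorphic_space
        subtopology (Euclidean_space DIM('a)) (g ` interior K)"
      by (simp add: homeomorphic_map_imp_homeomorphic_space)
  qed (use that in auto)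
  ultimately show ?thesis
    using interior_subset[of K] unfolding manifold_interior_def by auto
qed

text \<open>The cross product completes the frame; three nonzero orthogonal vectors give an
  injective, hence surjective, linear map.\<close>

lemma orthogonal_frame:
  fixes d e :: "real ^ 3"
  assumes "d \<bullet> e = 0" "d \<noteq> 0" "e \<noteq> 0"
  obtains f where "f \<noteq> 0" "d \<bullet> f = 0" "e \<bullet> f = 0" "\<And>x. \<exists>y s u. x = u *\<^sub>R e + s *\<^sub>R d + y *\<^sub>R f"
proof -
  define f where "f = cross3 d e"
  have f: "d \<bullet> f = 0" "e \<bullet> f = 0"
    by (simp_all add: f_def dot_cross_self)
  have "(norm f)\<^sup>2 = (norm d)\<^sup>2 * (norm e)\<^sup>2"
    using norm_cross[of d e] assms by (simp add: f_def)
  then have "f \<noteq> 0"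
    using assms by auto
  define L where "L = (\<lambda>v :: real ^ 3. v $ 1 *\<^sub>R e + v $ 2 *\<^sub>R d + v $ 3 *\<^sub>R f)"
  have lin: "linear L"
    by (rule linearI) (simp_all add: L_def algebra_simps)
  have "v = 0" if "L v = 0" for v
  proof -
    have "e \<bullet> L v = 0" "d \<bullet> L v = 0" "f \<bullet> L v = 0"
      using that by auto
    then have "v $ 1 = 0" "v $ 2 = 0" "v $ 3 = 0"
      using assms f \<open>f \<noteq> 0\<close> by (auto simp: L_def inner_add_right inner_commute)
    then show ?thesis
      by (simp add: vec_eq_iff forall_3)
  qed
  then have "surj L"
    using lin linear_injective_0 linear_injective_imp_surjective by blast
  then have "\<exists>y s u. x = u *\<^sub>R e + s *\<^sub>R d + y *\<^sub>R f" for x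
    by (metis L_def surjD)
  then show thesis
    using that f \<open>f \<noteq> 0\<close> by blast
qed

section \<open>Polynomial maps in a frame, and the case of a half-space\<close>

lemma real_polynomial_function_component: "real_polynomial_function (\<lambda>v :: real ^ 'n. v $ k)"
  by (intro real_polynomial_function.intros(1) bounded_linear_vec_nth)

lemma polynomial_map_frame:
  assumes "real_polynomial_function p" "real_polynomial_function q" "real_polynomial_function r"
  shows "polynomial_map (\<lambda>v. p v *\<^sub>R e + q v *\<^sub>R d + r v *\<^sub>R f)"
  unfolding polynomial_map_def vector_add_component vector_scaleR_component real_scaleR_def
  by (intro allI real_polynomial_function_intros assms)

lemma ex_vec3: "(\<exists>v :: real ^ 3. P (v $ 1) (v $ 2) (v $ 3)) \<longleftrightarrow> (\<exists>a b y. P a b y)"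
proof
  assume "\<exists>a b y. P a b y"
  then obtain a b y where "P a b y"
    by blast
  then have "P (v $ 1) (v $ 2) (v $ 3)" if "v = (vector [a, b, y] :: real ^ 3)" for v
    by (simp add: that)
  then show "\<exists>v :: real ^ 3. P (v $ 1) (v $ 2) (v $ 3)"
    by blast
qed blast

text \<open>For the closed half-space a square suffices. For the open one,
  \<open>(a * b - 1)\<^sup>2 + a\<^sup>2\<close> is positive with infimum 0, and together with
  \<open>b * (a * b - 1)\<close> it maps the plane onto an open half-plane.\<close>

lemma halfspace_polynomial_images:
  fixes n :: "real ^ 3"
  assumes "n \<noteq> 0"
  obtains f g :: "real ^ 3 \<Rightarrow> real ^ 3" where
    "polynomial_map f" "range f = {x. \<beta> < n \<bullet> x}"
    "polynomial_map g" "range g = {x. \<beta> \<le> n \<bullet> x}"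
proof -
  obtain e where e: "e \<noteq> 0" "n \<bullet> e = 0"
    using orthogonal_to_vector_exists[of n] by (auto simp: orthogonal_def)
  obtain d where d: "n \<bullet> d = 0" "e \<bullet> d = 0"
      "\<And>x. \<exists>y s u. x = u *\<^sub>R e + s *\<^sub>R n + y *\<^sub>R d"
    using orthogonal_frame[of n e] e assms by metis
  define A where "A = n \<bullet> n"
  have A: "0 < A"
    using assms by (simp add: A_def)
  have inner: "n \<bullet> (u *\<^sub>R e + s *\<^sub>R n + y *\<^sub>R d) = s * A" for u s y
    using e d by (simp add: inner_add_right A_def)
  define f where "f = (\<lambda>v :: real ^ 3. (v $ 2 * (v $ 1 * v $ 2 - 1)) *\<^sub>R e
    + ((\<beta> + ((v $ 1 * v $ 2 - 1)\<^sup>2 + (v $ 1)\<^sup>2)) / A) *\<^sub>R n + v $ 3 *\<^sub>R d)"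
  define g where "g = (\<lambda>v :: real ^ 3. v $ 2 *\<^sub>R e + ((\<beta> + (v $ 1)\<^sup>2) / A) *\<^sub>R n + v $ 3 *\<^sub>R d)"
  have "polynomial_map f" "polynomial_map g"
    unfolding f_def g_def
    by (intro polynomial_map_frame real_polynomial_function_intros
        real_polynomial_function_component)+
  moreover have "range f = {x. \<beta> < n \<bullet> x}"
  proof (intro equalityI subsetI)
    fix x assume "x \<in> range f"
    then obtain v where v: "x = f v"
      by blast
    have "(v $ 1 * v $ 2 - 1)\<^sup>2 + (v $ 1)\<^sup>2 \<noteq> 0"
      by (auto simp: sum_power2_eq_zero_iff)
    then have "0 < (v $ 1 * v $ 2 - 1)\<^sup>2 + (v $ 1)\<^sup>2"
      by (simp add: order_less_le)
    then show "x \<in> {x. \<beta> < n \<bullet> x}"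
      using A by (simp add: v f_def inner)
  next
    fix x assume "x \<in> {x. \<beta> < n \<bullet> x}"
    moreover obtain y s u where x: "x = u *\<^sub>R e + s *\<^sub>R n + y *\<^sub>R d"
      using d by blast
    ultimately have \<sigma>: "0 < s * A - \<beta>" (is "0 < ?\<sigma>")
      by (simp add: inner)
    have "\<exists>a b. b * (a * b - 1) = u \<and> (a * b - 1)\<^sup>2 + a\<^sup>2 = ?\<sigma>"
    proof (cases "u = 0")
      case True
      then show ?thesis
        using \<sigma> by (intro exI[of _ "sqrt ?\<sigma>"] exI[of _ "1 / sqrt ?\<sigma>"]) simp
    next
      case False
      \<comment> \<open>With \<open>r = a * b - 1\<close> the first equation gives
        \<open>b = u / r\<close> and \<open>a = (1 + r) * r / u\<close>; the second becomes
        \<open>?h r = ?\<sigma>\<close>, solved by the intermediate value theorem.\<close>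
      let ?h = "\<lambda>r. r\<^sup>2 + ((1 + r) * r / u)\<^sup>2"
      have "r \<le> (1 + r)\<^sup>2" if "0 < r" for r :: real
        using that zero_le_power2[of r] unfolding power2_sum by simp
      from this[OF \<sigma>] have "?\<sigma> \<le> ?h (1 + ?\<sigma>)"
        by (smt (verit) zero_le_power2)
      then have "\<exists>r\<ge>0. r \<le> 1 + ?\<sigma> \<and> ?h r = ?\<sigma>"
        using \<sigma> False by (intro IVT' continuous_intros) auto
      then obtain r where r: "0 \<le> r" "?h r = ?\<sigma>"
        by blast
      then have "r \<noteq> 0"
        using \<sigma> by auto
      then have "(1 + r) * r / u * (u / r) - 1 = r"
        using False by simp
      then show ?thesis
        using r \<open>r \<noteq> 0\<close> by (intro exI[of _ "(1 + r) * r / u"] exI[of _ "u / r"]) simp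
    qed
    then obtain a b where ab: "b * (a * b - 1) = u" "(a * b - 1)\<^sup>2 + a\<^sup>2 = ?\<sigma>"
      by blast
    have "x = f (vector [a, b, y])"
      using A by (simp add: f_def x ab)
    then show "x \<in> range f"
      by blast
  qed
  moreover have "range g = {x. \<beta> \<le> n \<bullet> x}"
  proof (intro equalityI subsetI)
    fix x assume "x \<in> range g"
    then show "x \<in> {x. \<beta> \<le> n \<bullet> x}"
      using A by (auto simp: g_def inner)
  next
    fix x assume "x \<in> {x. \<beta> \<le> n \<bullet> x}"
    moreover obtain y s u where x: "x = u *\<^sub>R e + s *\<^sub>R n + y *\<^sub>R d"
      using d by blast
    ultimately have "x = g (vector [sqrt (s * A - \<beta>), u, y])"
      using A by (simp add: g_def inner)
    then show "x \<in> range g"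
      by blast
  qed
  ultimately show thesis
    using that by blast
qed

text \<open>The difference of the two unit normals satisfies both sign conditions by the strict
  Cauchy-Schwarz inequality. These conditions are open, and the finitely many hyperplanes to be
  avoided are negligible.\<close>

lemma ex_transversal_direction:
  fixes \<alpha> :: "'i \<Rightarrow> 'a::euclidean_space"
  assumes F: "finite F" "\<And>h. h \<in> F \<Longrightarrow> \<alpha> h \<noteq> 0" and jk: "j \<in> F" "k \<in> F"
    and indep: "\<And>r. \<alpha> k \<noteq> r *\<^sub>R \<alpha> j"
  obtains e where "\<And>h. h \<in> F \<Longrightarrow> \<alpha> h \<bullet> e \<noteq> 0" "0 < \<alpha> j \<bullet> e" "\<alpha> k \<bullet> e < 0"
proof -
  let ?G = "{e. 0 < \<alpha> j \<bullet> e} \<inter> {e. \<alpha> k \<bullet> e < 0}" and ?N = "\<Union>h\<in>F. {e. \<alpha> h \<bullet> e = 0}"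
  let ?e = "\<alpha> j /\<^sub>R norm (\<alpha> j) - \<alpha> k /\<^sub>R norm (\<alpha> k)"
  have pos: "0 < norm (\<alpha> j)" "0 < norm (\<alpha> k)"
    using F jk by auto
  have "norm (\<alpha> j) *\<^sub>R \<alpha> k \<noteq> norm (\<alpha> k) *\<^sub>R \<alpha> j"
  proof
    assume "norm (\<alpha> j) *\<^sub>R \<alpha> k = norm (\<alpha> k) *\<^sub>R \<alpha> j"
    then have "(1 / norm (\<alpha> j)) *\<^sub>R norm (\<alpha> j) *\<^sub>R \<alpha> k = (1 / norm (\<alpha> j)) *\<^sub>R norm (\<alpha> k) *\<^sub>R \<alpha> j"
      by simp
    then show False
      using indep pos by simp
  qed
  then have "\<alpha> j \<bullet> \<alpha> k < norm (\<alpha> j) * norm (\<alpha> k)"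
    using norm_cauchy_schwarz[of "\<alpha> j" "\<alpha> k"] norm_cauchy_schwarz_eq[of "\<alpha> j" "\<alpha> k"] by auto
  then have "?e \<in> ?G"
    using pos by (auto simp: inner_diff_right inner_commute dot_square_norm power2_eq_square field_simps)
  moreover have "open ?G"
    using open_halfspace_gt[of 0 "\<alpha> j"] open_halfspace_lt[of "\<alpha> k" 0] by auto
  ultimately have "\<not> negligible ?G"
    using open_not_negligible by blast
  moreover have "negligible ?N"
    using F by (intro negligible_Union) (auto intro: negligible_hyperplane)
  ultimately have "\<not> ?G \<subseteq> ?N"
    using negligible_subset by blast
  then obtain e where "e \<in> ?G" "e \<notin> ?N"
    by blast
  then show thesis
    using that by auto
qed

lemma ex_separated_nodes:
  assumes "finite F" "\<And>h. h \<in> F \<Longrightarrow> s h \<noteq> (0 :: real)"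
  obtains \<nu> where "separated_nodes F \<nu>" "\<And>h. h \<in> F \<Longrightarrow> 0 < \<nu> h \<longleftrightarrow> 0 < s h"
    "\<And>h. h \<in> F \<Longrightarrow> \<nu> h < 0 \<longleftrightarrow> s h < 0"
proof -
  obtain idx :: "_ \<Rightarrow> nat" where idx: "inj_on idx F"
    using finite_imp_inj_to_nat_seg[OF assms(1)] by blast
  \<comment> \<open>Distinct integers with the prescribed signs; the summand 1 keeps index 0 away
    from the origin.\<close>
  define \<nu> where "\<nu> h = sgn (s h) * (real (idx h) + 1)" for h
  have "1 \<le> \<bar>\<nu> h - \<nu> k\<bar>" if "h \<in> F" "k \<in> F" "h \<noteq> k" for h k
  proof -
    have "idx h \<noteq> idx k"
      using idx that by (auto dest: inj_onD)
    then have "1 \<le> \<bar>real (idx h) - real (idx k)\<bar>"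
      by linarith
    then show ?thesis
      using assms(2)[OF that(1)] assms(2)[OF that(2)] by (auto simp: \<nu>_def sgn_if)
  qed
  then have "separated_nodes F \<nu>"
    using assms by unfold_locales (auto simp: \<nu>_def abs_mult abs_sgn_eq)
  then show thesis
    using that[of \<nu>] by (auto simp: \<nu>_def zero_less_mult_iff mult_less_0_iff sgn_if)
qed

lemma polyhedron_complement_polynomial_images:
  fixes \<alpha> :: "'i \<Rightarrow> real ^ 3"
  assumes F: "finite F" "\<And>h. h \<in> F \<Longrightarrow> \<alpha> h \<noteq> 0" and jk: "j \<in> F" "k \<in> F"
    and indep: "\<And>r. \<alpha> k \<noteq> r *\<^sub>R \<alpha> j"
  obtains f g :: "real ^ 3 \<Rightarrow> real ^ 3" where
    "polynomial_map f" "range f = - {x. \<forall>h\<in>F. \<alpha> h \<bullet> x \<le> \<beta> h}"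
    "polynomial_map g" "range g = - {x. \<forall>h\<in>F. \<alpha> h \<bullet> x < \<beta> h}"
proof -
  obtain e where e: "\<And>h. h \<in> F \<Longrightarrow> \<alpha> h \<bullet> e \<noteq> 0" and ej: "0 < \<alpha> j \<bullet> e" and ek: "\<alpha> k \<bullet> e < 0"
    using ex_transversal_direction[OF F jk indep] by blast
  \<comment> \<open>Both coefficients are positive and the components along \<open>e\<close> cancel,
    so \<open>d \<bullet> x \<le> \<delta>\<close> on the polyhedron although \<open>d\<close> is
    orthogonal to \<open>e\<close>.\<close>
  define d where "d = (- (\<alpha> k \<bullet> e)) *\<^sub>R \<alpha> j + (\<alpha> j \<bullet> e) *\<^sub>R \<alpha> k"
  define \<delta> where "\<delta> = (- (\<alpha> k \<bullet> e)) * \<beta> j + (\<alpha> j \<bullet> e) * \<beta> k"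
  have "d \<noteq> 0"
  proof
    assume "d = 0"
    then have "(1 / (\<alpha> j \<bullet> e)) *\<^sub>R (\<alpha> j \<bullet> e) *\<^sub>R \<alpha> k = (1 / (\<alpha> j \<bullet> e)) *\<^sub>R (\<alpha> k \<bullet> e) *\<^sub>R \<alpha> j"
      by (simp add: d_def)
    then show False
      using indep ej by simp
  qed
  moreover have de: "d \<bullet> e = 0"
    by (simp add: d_def inner_diff_left)
  moreover have "e \<noteq> 0"
    using ej by auto
  ultimately obtain p where p: "p \<noteq> 0" "d \<bullet> p = 0" "e \<bullet> p = 0"
      "\<And>x. \<exists>y s u. x = u *\<^sub>R e + s *\<^sub>R d + y *\<^sub>R p"
    using orthogonal_frame by metis
  obtain \<nu> where "separated_nodes F \<nu>" and \<nu>: "\<And>h. h \<in> F \<Longrightarrow> 0 < \<nu> h \<longleftrightarrow> 0 < \<alpha> h \<bullet> e"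
      "\<And>h. h \<in> F \<Longrightarrow> \<nu> h < 0 \<longleftrightarrow> \<alpha> h \<bullet> e < 0"
    using ex_separated_nodes[of F "\<lambda>h. \<alpha> h \<bullet> e"] F(1) e by blast
  interpret separated_nodes F \<nu>
    by fact
  define A where "A = d \<bullet> d"
  have A: "0 < A"
    using \<open>d \<noteq> 0\<close> by (simp add: A_def)
  \<comment> \<open>Normalised so that \<open>d \<bullet> \<Phi> u t y = 1 + \<delta> - t\<close>,
    which turns \<open>d \<bullet> x \<le> \<delta>\<close> into \<open>t \<ge> 1\<close>.\<close>
  define s where "s t = (1 + \<delta> - t) / A" for t
  define \<Phi> where "\<Phi> u t y = u *\<^sub>R e + s t *\<^sub>R d + y *\<^sub>R p" for u t y
  \<comment> \<open>The value of \<open>u\<close> at which the line through \<open>(t, y)\<close>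
    along \<open>e\<close> meets the bounding plane of \<open>h\<close>.\<close>
  define c where "c y t h = (\<beta> h - (s t * (\<alpha> h \<bullet> d) + y * (\<alpha> h \<bullet> p))) / (\<alpha> h \<bullet> e)" for y t h
  have surj: "\<exists>u t y. x = \<Phi> u t y" for x
  proof -
    obtain y r u where "x = u *\<^sub>R e + r *\<^sub>R d + y *\<^sub>R p"
      using p by blast
    then have "x = \<Phi> u (1 + \<delta> - r * A) y"
      using A by (simp add: \<Phi>_def s_def)
    then show ?thesis
      by blast
  qed
  have inj: "\<Phi> u t y = \<Phi> u' t' y' \<longleftrightarrow> u = u' \<and> t = t' \<and> y = y'" for u t y u' t' y'
  proof
    assume "\<Phi> u t y = \<Phi> u' t' y'"
    then have "e \<bullet> \<Phi> u t y = e \<bullet> \<Phi> u' t' y'" "d \<bullet> \<Phi> u t y = d \<bullet> \<Phi> u' t' y'"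
        "p \<bullet> \<Phi> u t y = p \<bullet> \<Phi> u' t' y'"
      by simp_all
    then show "u = u' \<and> t = t' \<and> y = y'"
      using A \<open>e \<noteq> 0\<close> p(1-3) de
      by (auto simp: \<Phi>_def s_def A_def inner_add_right inner_commute)
  qed simp
  have inner: "\<alpha> h \<bullet> \<Phi> u t y = u * (\<alpha> h \<bullet> e) + (s t * (\<alpha> h \<bullet> d) + y * (\<alpha> h \<bullet> p))" for h u t y
    by (simp add: \<Phi>_def inner_add_right)
  have less: "\<beta> h < \<alpha> h \<bullet> \<Phi> u t y \<longleftrightarrow> 0 < \<nu> h \<and> c y t h < u \<or> \<nu> h < 0 \<and> u < c y t h"
    if "h \<in> F" for h u t y
    using e[OF that] \<nu>[OF that] unfolding c_def inner
    by (cases "0 < \<alpha> h \<bullet> e") (auto simp: field_simps)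
  have le: "\<beta> h \<le> \<alpha> h \<bullet> \<Phi> u t y \<longleftrightarrow> 0 < \<nu> h \<and> c y t h \<le> u \<or> \<nu> h < 0 \<and> u \<le> c y t h"
    if "h \<in> F" for h u t y
    using e[OF that] \<nu>[OF that] unfolding c_def inner
    by (cases "0 < \<alpha> h \<bullet> e") (auto simp: field_simps)
  have empty: "\<exists>h\<in>F. 0 < \<nu> h \<and> c y t h < u \<or> \<nu> h < 0 \<and> u < c y t h" if "t < 1" for t u y
  proof (rule ccontr)
    let ?x = "\<Phi> u t y"
    assume "\<not> ?thesis"
    then have "\<alpha> h \<bullet> ?x \<le> \<beta> h" if "h \<in> F" for h
      using less[OF that, of u t y] that by force
    then have "(- (\<alpha> k \<bullet> e)) * (\<alpha> j \<bullet> ?x) + (\<alpha> j \<bullet> e) * (\<alpha> k \<bullet> ?x) \<le> \<delta>"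
      unfolding \<delta>_def using jk ej ek by (intro add_mono mult_left_mono) auto
    then have "d \<bullet> ?x \<le> \<delta>"
      by (simp add: d_def inner_diff_left)
    moreover have "d \<bullet> ?x = 1 + \<delta> - t"
      using A de p by (simp add: \<Phi>_def inner_add_right s_def A_def)
    ultimately show False
      using \<open>t < 1\<close> by simp
  qed
  have pos: "0 < \<nu> j" "\<nu> k < 0"
    using \<nu> jk ej ek by auto
  define f where "f v = \<Phi> (height (c (v $ 3) (v $ 1 * nodal (v $ 2) * (v $ 2)\<^sup>2)) (v $ 2)
    (v $ 1 * nodal (v $ 2))) (v $ 1 * nodal (v $ 2) * (v $ 2)\<^sup>2) (v $ 3)" for v :: "real ^ 3"
  define g where "g v = \<Phi> (height (c (v $ 3) (v $ 1 * (v $ 2)\<^sup>2)) (v $ 2) (v $ 1))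
    (v $ 1 * (v $ 2)\<^sup>2) (v $ 3)" for v :: "real ^ 3"
  have "polynomial_map f"
    unfolding f_def \<Phi>_def s_def c_def
    by (intro polynomial_map_frame real_polynomial_function_height real_polynomial_function_intros
        real_polynomial_function_nodal real_polynomial_function_component)
  moreover have "polynomial_map g"
    unfolding g_def \<Phi>_def s_def c_def
    by (intro polynomial_map_frame real_polynomial_function_height real_polynomial_function_intros
        real_polynomial_function_component)
  moreover have "range f = - {x. \<forall>h\<in>F. \<alpha> h \<bullet> x \<le> \<beta> h}"
  proof -
    \<comment> \<open>Since \<open>\<Phi>\<close> is injective and the map prescribes
      \<open>t\<close> and \<open>y\<close>, membership reduces to the fibre over
      \<open>(t, y)\<close>.\<close>
    have "\<Phi> u t y \<in> range f \<longleftrightarrow> (\<exists>h\<in>F. \<beta> h < \<alpha> h \<bullet> \<Phi> u t y)" for u t y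
    proof -
      let ?P = "\<lambda>a b z. u = height (c z (a * nodal b * b\<^sup>2)) b (a * nodal b)
        \<and> t = a * nodal b * b\<^sup>2 \<and> y = z"
      have "\<Phi> u t y \<in> range f \<longleftrightarrow> (\<exists>v :: real ^ 3. ?P (v $ 1) (v $ 2) (v $ 3))"
        by (simp add: image_iff f_def inj)
      also have "\<dots> \<longleftrightarrow> (\<exists>a b z. ?P a b z)"
        by (rule ex_vec3[of ?P])
      also have "\<dots> \<longleftrightarrow> (\<exists>a b. a * nodal b * b\<^sup>2 = t \<and> height (c y t) b (a * nodal b) = u)"
        by blast
      also have "\<dots> \<longleftrightarrow> (\<exists>h\<in>F. \<beta> h < \<alpha> h \<bullet> \<Phi> u t y)"
        using open_fibre[OF jk(1) pos(1) jk(2) pos(2) empty] less by simp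
      finally show ?thesis .
    qed
    then have "x \<in> range f \<longleftrightarrow> (\<exists>h\<in>F. \<beta> h < \<alpha> h \<bullet> x)" for x
      using surj[of x] by metis
    then show ?thesis
      unfolding set_eq_iff Compl_iff mem_Collect_eq by (metis not_le)
  qed
  moreover have "range g = - {x. \<forall>h\<in>F. \<alpha> h \<bullet> x < \<beta> h}"
  proof -
    have "\<Phi> u t y \<in> range g \<longleftrightarrow> (\<exists>h\<in>F. \<beta> h \<le> \<alpha> h \<bullet> \<Phi> u t y)" for u t y
    proof -
      let ?P = "\<lambda>a b z. u = height (c z (a * b\<^sup>2)) b a \<and> t = a * b\<^sup>2 \<and> y = z"
      have "\<Phi> u t y \<in> range g \<longleftrightarrow> (\<exists>v :: real ^ 3. ?P (v $ 1) (v $ 2) (v $ 3))"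
        by (simp add: image_iff g_def inj)
      also have "\<dots> \<longleftrightarrow> (\<exists>a b z. ?P a b z)"
        by (rule ex_vec3[of ?P])
      also have "\<dots> \<longleftrightarrow> (\<exists>a b. a * b\<^sup>2 = t \<and> height (c y t) b a = u)"
        by blast
      also have "\<dots> \<longleftrightarrow> (\<exists>h\<in>F. \<beta> h \<le> \<alpha> h \<bullet> \<Phi> u t y)"
        using closed_fibre[OF jk(1) pos(1) jk(2) pos(2) empty] le by simp
      finally show ?thesis .
    qed
    then have "x \<in> range g \<longleftrightarrow> (\<exists>h\<in>F. \<beta> h \<le> \<alpha> h \<bullet> x)" for x
      using surj[of x] by metis
    then show ?thesis
      unfolding set_eq_iff Compl_iff mem_Collect_eq by (metis not_less)
  qed
  ultimately show thesis
    using that by blast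
qed

section \<open>Interiors, layers and the final case distinction\<close>

lemma interior_finite_Inter_halfspaces:
  fixes \<alpha> :: "'i \<Rightarrow> 'a::euclidean_space"
  assumes "finite F" "\<And>h. h \<in> F \<Longrightarrow> \<alpha> h \<noteq> 0"
  shows "interior {x. \<forall>h\<in>F. \<alpha> h \<bullet> x \<le> \<beta> h} = {x. \<forall>h\<in>F. \<alpha> h \<bullet> x < \<beta> h}" (is "interior ?K = ?I")
proof
  have "interior ?K \<subseteq> {x. \<alpha> h \<bullet> x < \<beta> h}" if "h \<in> F" for h
    using interior_mono[of ?K "{x. \<alpha> h \<bullet> x \<le> \<beta> h}"] that assms by auto
  then show "interior ?K \<subseteq> ?I"
    by blast
  have "?I = (\<Inter>h\<in>F. {x. \<alpha> h \<bullet> x < \<beta> h})"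
    by blast
  then have "open ?I"
    using assms by (simp add: open_INT open_halfspace_lt)
  then show "?I \<subseteq> interior ?K"
    by (intro interior_maximal) auto
qed

text \<open>The inner product with \<open>n\<close> maps the complement onto \<open>- S\<close>,
  which is then an interval; being unbounded on both sides, it is the whole line.\<close>

lemma connected_compl_layer_imp_empty:
  fixes n :: "'a::real_inner"
  assumes "connected (- {x. n \<bullet> x \<in> S})" "bounded S" "n \<noteq> 0"
  shows "S = {}"
proof -
  have surj: "\<exists>x. n \<bullet> x = s" for s
    using assms(3) by (intro exI[of _ "(s / (n \<bullet> n)) *\<^sub>R n"]) simp
  have "(\<lambda>x. n \<bullet> x) ` (- {x. n \<bullet> x \<in> S}) = - S"
  proof (intro equalityI subsetI)
    fix s assume "s \<in> - S"
    moreover obtain x where "n \<bullet> x = s"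
      using surj by blast
    ultimately show "s \<in> (\<lambda>x. n \<bullet> x) ` (- {x. n \<bullet> x \<in> S})"
      by auto
  qed auto
  then have conn: "connected (- S)"
    using connected_continuous_image[OF _ assms(1), of "\<lambda>x. n \<bullet> x"]
    by (simp add: continuous_on_inner)
  obtain B where B: "\<And>s. s \<in> S \<Longrightarrow> \<bar>s\<bar> \<le> B"
    using assms(2) by (auto simp: bounded_iff)
  have "s \<notin> S" for s
  proof -
    have "\<bar>s\<bar> + \<bar>B\<bar> + 1 \<in> - S" "- \<bar>s\<bar> - \<bar>B\<bar> - 1 \<in> - S"
      using B by force+
    then have "s \<in> - S"
      using conn[unfolded connected_iff_interval] by (smt (verit) ComplI)
    then show ?thesis
      by simp
  qed
  then show ?thesis
    by blast
qed

theorem mainTheorem1: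
  fixes K :: "(real ^ 3) set"
  assumes "polyhedron K"
    and "manifold_with_boundary 3 (top_of_set K)"
    and "\<not> bounded K"
    and "\<not> disconnects K"
    and "K \<noteq> UNIV"
  shows "(\<exists>f :: real ^ 3 \<Rightarrow> real ^ 3. polynomial_map f \<and> range f = UNIV - K) \<and>
    (\<exists>g :: real ^ 3 \<Rightarrow> real ^ 3. polynomial_map g \<and>
       range g = UNIV - manifold_interior 3 (top_of_set K))"
proof -
  obtain F where F: "finite F" "K = \<Inter> F" "\<forall>h\<in>F. \<exists>a b. a \<noteq> 0 \<and> h = {x. a \<bullet> x \<le> b}"
    using assms(1) by (auto simp: polyhedron_def)
  then obtain \<alpha> \<beta> where ab: "\<And>h. h \<in> F \<Longrightarrow> \<alpha> h \<noteq> 0" "\<And>h. h \<in> F \<Longrightarrow> h = {x. \<alpha> h \<bullet> x \<le> \<beta> h}"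
    by metis
  have K: "K = {x. \<forall>h\<in>F. \<alpha> h \<bullet> x \<le> \<beta> h}"
    unfolding F(2) using ab(2) by blast
  have "manifold_interior 3 (top_of_set K) = interior K"
    using manifold_interior_eq_interior[of K] by simp
  also have "\<dots> = {x. \<forall>h\<in>F. \<alpha> h \<bullet> x < \<beta> h}"
    unfolding K using F(1) ab(1) by (rule interior_finite_Inter_halfspaces)
  finally have mint: "manifold_interior 3 (top_of_set K) = {x. \<forall>h\<in>F. \<alpha> h \<bullet> x < \<beta> h}" .
  show ?thesis
  proof (cases "\<exists>j\<in>F. \<exists>k\<in>F. \<forall>r. \<alpha> k \<noteq> r *\<^sub>R \<alpha> j")
    case True
    then obtain j k where jk: "j \<in> F" "k \<in> F" and indep: "\<And>r. \<alpha> k \<noteq> r *\<^sub>R \<alpha> j"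
      by blast
    obtain f g :: "real ^ 3 \<Rightarrow> real ^ 3" where
      "polynomial_map f" "range f = - {x. \<forall>h\<in>F. \<alpha> h \<bullet> x \<le> \<beta> h}"
      "polynomial_map g" "range g = - {x. \<forall>h\<in>F. \<alpha> h \<bullet> x < \<beta> h}"
      by (rule polyhedron_complement_polynomial_images[OF F(1) ab(1) jk indep])
    then show ?thesis
      unfolding mint Compl_eq_Diff_UNIV K[symmetric] by blast
  next
    case False
    \<comment> \<open>Here \<open>K \<noteq> UNIV\<close> provides a half-space; the range of a map
      is never empty.\<close>
    obtain j where j: "j \<in> F"
      using assms(5) F(2) by auto
    define n where "n = \<alpha> j"
    have n: "n \<noteq> 0"
      using ab(1) j by (simp add: n_def)
    obtain r where r: "\<And>h. h \<in> F \<Longrightarrow> \<alpha> h = r h *\<^sub>R n"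
      using False j unfolding n_def by metis
    define S where "S = {s. \<forall>h\<in>F. r h * s \<le> \<beta> h}"
    have KS: "K = {x. n \<bullet> x \<in> S}"
      unfolding K S_def using r by auto
    have "S \<noteq> {}"
      using assms(3) KS by auto
    moreover have "connected (- {x. n \<bullet> x \<in> S})"
      using assms(4) by (simp add: disconnects_def KS Compl_eq_Diff_UNIV)
    ultimately have unbdd: "\<not> bounded S"
      using connected_compl_layer_imp_empty n by blast
    have "r j *\<^sub>R n = 1 *\<^sub>R n"
      unfolding r[OF j, symmetric] by (simp add: n_def)
    then have "r j = 1"
      using n by (simp only: scaleR_cancel_right) simp
    \<comment> \<open>Opposite normals would confine \<open>S\<close> to a bounded interval, making
      \<open>K\<close> a layer. Hence all normals point the same way and \<open>K\<close> is a
      single half-space.\<close>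
    have rpos: "0 < r h" if h: "h \<in> F" for h
    proof (rule ccontr)
      assume "\<not> 0 < r h"
      moreover have "r h \<noteq> 0"
        using r[OF h] ab(1)[OF h] by auto
      ultimately have neg: "r h < 0"
        by simp
      have "S \<subseteq> {\<beta> h / r h..\<beta> j}"
      proof
        fix s assume "s \<in> S"
        then have "r h * s \<le> \<beta> h" "r j * s \<le> \<beta> j"
          using h j unfolding S_def by blast+
        then show "s \<in> {\<beta> h / r h..\<beta> j}"
          using neg \<open>r j = 1\<close> by (simp add: neg_divide_le_eq mult.commute)
      qed
      then show False
        using unbdd bounded_subset bounded_closed_interval by blast
    qed
    define m where "m = Min ((\<lambda>h. \<beta> h / r h) ` F)"
    have "finite ((\<lambda>h. \<beta> h / r h) ` F)" "(\<lambda>h. \<beta> h / r h) ` F \<noteq> {}"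
      using F(1) j by auto
    then have "s \<le> m \<longleftrightarrow> (\<forall>h\<in>F. s \<le> \<beta> h / r h)" "s < m \<longleftrightarrow> (\<forall>h\<in>F. s < \<beta> h / r h)" for s
      unfolding m_def by simp_all
    then have "s \<le> m \<longleftrightarrow> (\<forall>h\<in>F. r h * s \<le> \<beta> h)" "s < m \<longleftrightarrow> (\<forall>h\<in>F. r h * s < \<beta> h)" for s
      using rpos by (simp_all add: pos_le_divide_eq pos_less_divide_eq mult.commute)
    then have le: "n \<bullet> x \<le> m \<longleftrightarrow> (\<forall>h\<in>F. \<alpha> h \<bullet> x \<le> \<beta> h)"
      and less: "n \<bullet> x < m \<longleftrightarrow> (\<forall>h\<in>F. \<alpha> h \<bullet> x < \<beta> h)" for x
      using r by auto
    have compl: "UNIV - K = {x. m < n \<bullet> x}"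
        "UNIV - {x. \<forall>h\<in>F. \<alpha> h \<bullet> x < \<beta> h} = {x. m \<le> n \<bullet> x}"
      unfolding K le[symmetric] less[symmetric] by auto
    obtain f g :: "real ^ 3 \<Rightarrow> real ^ 3" where
      "polynomial_map f" "range f = {x. m < n \<bullet> x}"
      "polynomial_map g" "range g = {x. m \<le> n \<bullet> x}"
      by (rule halfspace_polynomial_images[OF n])
    then show ?thesis
      unfolding mint compl by blast
  qed
qed

end
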